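(* Let $q \ge 2$ be an integer and let $a_2, \dots, a_q$ be integers with $a_i \ge 1$ for $2 \le i \le q$ and $a_q \ge 2$. Consider the power series $$T(X) = 2 - \frac{1}{1-X} - \sum_{i=2}^{q} (a_i - 1) X^{i-1}.$$ For a positive integer $r$ put $k = k(r) = 1 + rq$ and $c = c(r) = 2 + (r-1)q$. Let $p_k(X)$ be the degree-$k$ Taylor polynomial of $T(X)$, i.e. $$p_k(X) = 2 - \frac{X^{k+1}-1}{X-1} - \sum_{i=2}^{q} (a_i-1)X^{i-1} = \sum_{j=0}^{k} c_j X^j \quad (\text{note } c_k=-1).$$ Let $\{G_n\}_{n\ge1}$ be the sequence with $G_1 = 1$, $G_i = 0$ for $2 \le i \le k$, and $G_n = \sum_{j=0}^{k-1} c_j G_{n-k+j}$ for $n > k$. Explicitly, this recursion is $$G_n = G_{n-k} - \left(a_2 G_{n-k+1} + \cdots + a_q G_{n-k+q-1}\right) - \left(G_{n-k+q} + \cdots + G_{n-1}\right).$$ For integers $i, j$ with $k + (i-1)c + j \ge 1$ set $R_{i,j} = G_{k+(i-1)c+j}$. Thus $R_{t,s}$ for $1\le t\le r$, $1\le s\le c$ is the $r\times c$ rectangle formed by $G_{k+1},\dots,G_{k+rc}$ written row by row. This convention gives $R_{0,u} = 0$ for $1 \le u \le c$ and $R_{t,1-s} = R_{t-1,c+1-s}$. Define $l(t) = 2 + (t-1)q$. Then: (i) $R_{1,1} = 1$, $R_{1,2} = -1$, and $R_{1,u} = 0$ for $3 \le u \le c$. (ii) For $2 \le i \le r$ and $1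 \le j \le c$, the entries $R_{i,j}$ satisfy the recursion defining $G$ and also the triangle recursion $$R_{i,j} = -(a_q - 1) R_{i-1,j} - \sum_{e=2}^{q-1} (a_e - a_{e+1}) R_{i-1,\,j-q+e} + (1 + a_2) R_{i-1,\,j-q+1} - R_{i-1,\,j-q}.$$ (iii) $R_{t,1} \neq 0$ for $1 \le t \le r$. (iv) For $1 \le t \le r$, $R_{t,l(t)} \neq 0$ and $R_{t,u} = 0$ for all $l(t) < u \le c$. In particular $l(t)$ is the column position of the last nonzero entry in row $t$. (v) The family of these sequences (over all $r \ge 1$) has a triangle embedded in it. That is, for each $r$ the sequence $l(1), \dots, l(r)$ is strictly increasing. Moreover, any two members are compatible: for orders $k(r_1)$ and $k(r_2)$ with rectangles $R^{(r_1)}$ and $R^{(r_2)}$, the last-nonzero positions agree, and $R^{(r_1)}_{t,s} = R^{(r_2)}_{t,s}$ for $1 \le s \le l(t)$ and $1 \le t \le \min(r_1, r_2)$.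
   Context: Convention: a polynomial $p(X)=\sum_{j=0}^k c_jX^j$ with leading coefficient $c_k=-1$ is regarded as the characteristic polynomial of the order-$k$ recursion $G_n=\sum_{j=0}^{k-1}c_jG_{n-k+j}$. The family of recursive sequences associated with a Taylor series consists of, for each order $k$, the sequence satisfying the recursion attached to the degree-$k$ Taylor polynomial, with initial values $G_1=1$ and $G_i=0$ for $2\le i\le k$. The sequence of order $k(r)$ has a triangle embedded in it if, in its $r\times c(r)$ rectangle, the last nonzero position $l(t)$ of each row $t$ (nonzero at $l(t)$, zero afterwards) exists and $l(1)<\dots<l(r)$. *)

theory Defs
  imports Complex_Main "HOL-Computational_Algebra.Polynomial_FPS"
begin

text \<open>
  A polynomial of degree \<open>k\<close> with coefficients \<open>c\<^sub>j\<close> and leading coefficient \<open>-1\<close> encodes the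
  recursion \<open>G\<^sub>n = (\<Sum>j<k. c\<^sub>j G\<^bsub>n-k+j\<^esub>)\<close> of order \<open>k\<close>. Sequences are indexed from 1 on; the value
  at index 0 is never used, since \<open>n - k + j \<ge> 1\<close> whenever \<open>n > k\<close>.
\<close>

function rec_seq :: "real poly \<Rightarrow> nat \<Rightarrow> real" where
  "rec_seq p n =
     (if n \<le> degree p then (if n = 1 then 1 else 0)
      else (\<Sum>j<degree p. coeff p j * rec_seq p (n - degree p + j)))"
  by auto
termination
  by (relation "measure snd") auto

declare rec_seq.simps [simp del]

definition taylor_poly :: "nat \<Rightarrow> real fps \<Rightarrow> real poly" where
  "taylor_poly k T = truncate_fps (k + 1) T"

definition taylor_seq :: "real fps \<Rightarrow> nat \<Rightarrow> nat \<Rightarrow> real" where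
  "taylor_seq T k = rec_seq (taylor_poly k T)"

text \<open>
  Row and column indices are integers, because columns \<open>\<le> 0\<close> (which run back into the preceding
  rows) and row 0 occur as well. The entry is meaningful when \<open>k + (i - 1) c + j \<ge> 1\<close>.
\<close>

definition rect :: "(nat \<Rightarrow> real) \<Rightarrow> nat \<Rightarrow> nat \<Rightarrow> int \<Rightarrow> int \<Rightarrow> real" where
  "rect G k c i j = G (nat (int k + (i - 1) * int c + j))"

definition last_nonzero :: "(int \<Rightarrow> real) \<Rightarrow> nat \<Rightarrow> int \<Rightarrow> bool" where
  "last_nonzero row c p \<longleftrightarrow>
     1 \<le> p \<and> p \<le> int c \<and> row p \<noteq> 0 \<and> (\<forall>u. p < u \<and> u \<le> int c \<longrightarrow> row u = 0)"

definition triangle_embedded :: "(nat \<Rightarrow> real) \<Rightarrow> nat \<Rightarrow> nat \<Rightarrow> nat \<Rightarrow> bool" where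
  "triangle_embedded G k r c \<longleftrightarrow>
     (\<exists>l. (\<forall>t\<in>{1..int r}. last_nonzero (rect G k c t) c (l t)) \<and> strict_mono_on {1..int r} l)"

definition family_triangle_embedded ::
    "(nat \<Rightarrow> nat \<Rightarrow> real) \<Rightarrow> (nat \<Rightarrow> nat) \<Rightarrow> (nat \<Rightarrow> nat) \<Rightarrow> bool" where
  "family_triangle_embedded F k c \<longleftrightarrow> (\<forall>r\<ge>1. triangle_embedded (F (k r)) (k r) r (c r))"

definition T :: "nat \<Rightarrow> (nat \<Rightarrow> int) \<Rightarrow> real fps" where
  "T q a = 2 - 1 / (1 - fps_X) - (\<Sum>i=2..q. fps_const (of_int (a i - 1)) * fps_X ^ (i - 1))"

definition ord_k :: "nat \<Rightarrow> nat \<Rightarrow> nat" where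
  "ord_k q r = 1 + r * q"

text \<open>The natural-number subtraction is exact because only \<open>r \<ge> 1\<close> is used.\<close>

definition col_c :: "nat \<Rightarrow> nat \<Rightarrow> nat" where
  "col_c q r = 2 + (r - 1) * q"

definition pk :: "nat \<Rightarrow> (nat \<Rightarrow> int) \<Rightarrow> nat \<Rightarrow> real poly" where
  "pk q a r = taylor_poly (ord_k q r) (T q a)"

definition R :: "nat \<Rightarrow> (nat \<Rightarrow> int) \<Rightarrow> nat \<Rightarrow> int \<Rightarrow> int \<Rightarrow> real" where
  "R q a r = rect (taylor_seq (T q a) (ord_k q r)) (ord_k q r) (col_c q r)"

definition l_pos :: "nat \<Rightarrow> int \<Rightarrow> int" where
  "l_pos q t = 2 + (t - 1) * int q"

lemma T_nth:
  "fps_nth (T q a) j =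
     (if j = 0 then 1 else if j < q then - of_int (a (j + 1)) else - 1)"
proof -
  have geo: "(1 :: real fps) / (1 - fps_X) = Abs_fps (\<lambda>_. 1)"
    by (simp add: fps_divide_unit fps_inverse_gp' [symmetric])
  have S: "fps_nth (\<Sum>i=2..q. fps_const (of_int (a i - 1) :: real) * fps_X ^ (i - 1)) j =
        (\<Sum>i=2..q. if i = j + 1 then of_int (a i - 1) else 0)"
    unfolding fps_sum_nth by (intro sum.cong) auto
  have two: "fps_nth (2 :: real fps) j = (if j = 0 then 2 else 0)"
    by (simp add: numeral_fps_const)
  show ?thesis
    unfolding T_def geo fps_sub_nth S two by (auto simp: sum.delta')
qed

lemma coeff_pk:
  "coeff (pk q a r) j =
     (if j > ord_k q r then 0 else if j = 0 then 1
      else if j < q then - of_int (a (j + 1)) else - 1)"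
  by (simp add: pk_def taylor_poly_def coeff_truncate_fps T_nth)

lemma q_le_ord_k:
  assumes "r \<ge> 1"
  shows "q < ord_k q r"
  using assms by (cases r) (auto simp: ord_k_def)

lemma degree_pk:
  assumes "r \<ge> 1"
  shows "degree (pk q a r) = ord_k q r"
proof (rule antisym)
  show "degree (pk q a r) \<le> ord_k q r"
    by (rule degree_le) (simp add: coeff_pk)
  show "ord_k q r \<le> degree (pk q a r)"
    by (rule le_degree) (use q_le_ord_k[OF assms, of q] in \<open>simp add: coeff_pk\<close>)
qed

lemma lead_coeff_pk:
  assumes "r \<ge> 1"
  shows "coeff (pk q a r) (ord_k q r) = - 1"
  using q_le_ord_k[OF assms, of q] by (simp add: coeff_pk)

lemma pk_explicit:
  assumes "r \<ge> 1"
  shows "pk q a r =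
    2 - (monom 1 (ord_k q r + 1) - 1) div [:- 1, 1:]
      - (\<Sum>i=2..q. monom (of_int (a i - 1)) (i - 1))"
proof -
  let ?k = "ord_k q r"
  let ?S = "\<Sum>i\<le>?k. monom (1 :: real) i"
  have X: "monom (1 :: real) i = [:0, 1:] ^ i" for i
    by (simp add: monom_altdef)
  have "monom 1 (?k + 1) - 1 = ([:0, 1:] - 1) * ?S"
    unfolding X using power_diff_1_eq[of "[:0, 1:] :: real poly" "Suc ?k"]
    by (simp add: lessThan_Suc_atMost del: power_Suc)
  also have "[:0, 1:] - 1 = ([:- 1, 1:] :: real poly)"
    by (simp add: one_pCons)
  finally have div: "(monom 1 (?k + 1) - 1) div [:- 1, 1:] = ?S"
    by (metis nonzero_mult_div_cancel_left one_neq_zero pCons_eq_0_iff)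
  have two: "coeff (2 :: real poly) j = (if j = 0 then 2 else 0)" for j
    by (simp add: numeral_poly coeff_pCons split: nat.splits)
  have S1: "coeff ?S j = (if j \<le> ?k then 1 else 0)" for j
    by (simp add: coeff_sum)
  have S2: "coeff (\<Sum>i=2..q. monom (of_int (a i - 1) :: real) (i - 1)) j =
        (\<Sum>i=2..q. if i = j + 1 then of_int (a i - 1) else 0)" for j
    unfolding coeff_sum by (intro sum.cong) auto
  show ?thesis
    unfolding div
    by (rule poly_eqI, unfold coeff_diff S1 S2 two coeff_pk)
       (use q_le_ord_k[OF assms, of q] in auto)
qed

lemma rect_row0:
  assumes "q \<ge> 2" "r \<ge> 1" "1 \<le> u" "u \<le> int (col_c q r)"
  shows "R q a r 0 u = 0"
proof -
  have e: "int (ord_k q r) - int (col_c q r) = int q - 1"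
    using assms(2) by (cases r) (auto simp: ord_k_def col_c_def algebra_simps)
  have "nat (int (ord_k q r) - int (col_c q r) + u) \<le> ord_k q r"
    using assms(4) by linarith
  moreover have "nat (int (ord_k q r) - int (col_c q r) + u) \<noteq> 1"
    using assms(1,3) e by linarith
  ultimately show ?thesis
    using degree_pk[OF assms(2), of q a]
    by (simp add: R_def rect_def taylor_seq_def pk_def rec_seq.simps)
qed

lemma rect_wrap: "R q a r t (1 - s) = R q a r (t - 1) (int (col_c q r) + 1 - s)"
  by (simp add: R_def rect_def algebra_simps)

end

theory Submission
  imports Defs
begin

text \<open>
  Subtracting consecutive instances of the order-\<open>k\<close> recursion leaves a recursion that reaches back
  only to the indices \<open>n - c, \<dots>, n - c - q\<close>, with fixed coefficients \<open>w\<^sub>0, \<dots>, w\<^sub>q\<close>. Since \<open>c\<close> is the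
  row length, each row arises from the preceding one by convolution with \<open>W = \<Sum>d\<le>q. w\<^sub>d X\<^sup>d\<close>: the
  entries that wrap around to the end of the row before vanish, because that row ends in sufficiently
  many zeros. Hence row \<open>t\<close> is the coefficient list of \<open>(1 - X) W\<^bsup>t-1\<^esup>\<close>, which does not depend on \<open>r\<close>,
  has degree \<open>1 + (t - 1) q\<close> and nonzero constant term \<open>(1 - a\<^sub>q)\<^bsup>t-1\<^esup>\<close>.
\<close>

section \<open>Coefficients at integer positions and the row polynomials\<close>

definition int_coeff :: "'a::zero poly \<Rightarrow> int \<Rightarrow> 'a" where
  "int_coeff p z = (if z < 0 then 0 else coeff p (nat z))"

lemma int_coeff_add: "int_coeff (p + p') z = int_coeff p z + int_coeff p' z"
  by (simp add: int_coeff_def)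

lemma int_coeff_diff:
  fixes p :: "'a::ab_group_add poly"
  shows "int_coeff (p - p') z = int_coeff p z - int_coeff p' z"
  by (simp add: int_coeff_def)

lemma int_coeff_sum: "int_coeff (\<Sum>i\<in>A. f i) z = (\<Sum>i\<in>A. int_coeff (f i) z)"
  by (simp add: int_coeff_def coeff_sum)

text \<open>Integer positions make multiplication by a monomial a pure shift: for
  \<open>z < int d\<close> both sides are 0, so no lower boundary has to be treated separately
  later.\<close>

lemma int_coeff_monom_mult:
  fixes p :: "'a::comm_semiring_1 poly"
  shows "int_coeff (monom x d * p) z = x * int_coeff p (z - int d)"
  by (auto simp: int_coeff_def coeff_monom_mult nat_diff_distrib)

lemma int_coeff_eq_0:
  assumes "int (degree p) < z"
  shows "int_coeff p z = 0"
  using assms by (auto simp: int_coeff_def intro!: coeff_eq_0)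

text \<open>The factor at \<open>X^d\<close> weights the entry \<open>d\<close> columns to the left
  in the preceding row. Column \<open>j - q + e\<close> of the triangle recursion thus contributes
  exponent \<open>q - e\<close>; the terms outside the sum are \<open>e = q\<close>,
  \<open>e = 1\<close> and \<open>e = 0\<close>.\<close>

definition row_mult :: "nat \<Rightarrow> (nat \<Rightarrow> int) \<Rightarrow> real poly" where
  "row_mult q a =
     monom (- of_int (a q - 1)) 0
     - (\<Sum>e=2..q-1. monom (of_int (a e - a (e + 1))) (q - e))
     + monom (of_int (1 + a 2)) (q - 1)
     - monom 1 q"

text \<open>The exponent \<open>m\<close> counts the steps down from row 1: row \<open>t\<close> has
  \<open>m = t - 1\<close>, and its column \<open>j\<close> holds the coefficient at
  \<open>j - 1\<close>.\<close>

definition row_poly :: "nat \<Rightarrow> (nat \<Rightarrow> int) \<Rightarrow> nat \<Rightarrow> real poly" where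
  "row_poly q a m = [:1, - 1:] * row_mult q a ^ m"

lemma coeff_row_mult_0:
  assumes "q \<ge> 2"
  shows "coeff (row_mult q a) 0 = - of_int (a q - 1)"
proof -
  have "(\<Sum>e=2..q-1. coeff (monom (of_int (a e - a (e + 1)) :: real) (q - e)) 0) = 0"
    using assms by (intro sum.neutral) auto
  then show ?thesis
    using assms unfolding row_mult_def coeff_add coeff_diff coeff_sum by simp
qed

lemma coeff_row_mult_top:
  assumes "q \<ge> 2"
  shows "coeff (row_mult q a) q = - 1"
proof -
  have "(\<Sum>e=2..q-1. coeff (monom (of_int (a e - a (e + 1)) :: real) (q - e)) q) = 0"
    by (intro sum.neutral) auto
  then show ?thesis
    using assms unfolding row_mult_def coeff_add coeff_diff coeff_sum by simp
qed

lemma degree_row_mult: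
  assumes "q \<ge> 2"
  shows "degree (row_mult q a) = q"
proof (rule antisym)
  show "degree (row_mult q a) \<le> q"
    unfolding row_mult_def
    by (intro degree_diff_le degree_add_le degree_sum_le) (auto intro!: order.trans[OF degree_monom_le])
  show "q \<le> degree (row_mult q a)"
    by (rule le_degree) (simp add: coeff_row_mult_top assms)
qed

lemma row_poly_nonzero:
  assumes "q \<ge> 2"
  shows "row_poly q a m \<noteq> 0"
  using coeff_row_mult_top[OF assms, of a] by (auto simp: row_poly_def simp del: mult_pCons_left)

lemma degree_row_poly:
  assumes "q \<ge> 2"
  shows "degree (row_poly q a m) = 1 + m * q"
proof -
  have "row_mult q a \<noteq> 0"
    using coeff_row_mult_top[OF assms, of a] by auto
  then show ?thesis
    unfolding row_poly_def
    by (subst degree_mult_eq) (auto simp: degree_power_eq degree_row_mult assms)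
qed

lemma coeff_row_poly_0:
  assumes "q \<ge> 2"
  shows "coeff (row_poly q a m) 0 = (- of_int (a q - 1)) ^ m"
  by (simp add: row_poly_def coeff_mult_0 coeff_0_power coeff_row_mult_0 assms del: mult_pCons_left)

lemma int_coeff_row_poly_0:
  "int_coeff (row_poly q a 0) z = (if z = 0 then 1 else if z = 1 then - 1 else 0)"
proof -
  consider "z < 0" | "z = 0" | "z = 1" | "z > 1" by linarith
  then show ?thesis
    by cases (auto simp: int_coeff_def row_poly_def intro!: coeff_eq_0)
qed

text \<open>Expanding one factor \<open>row_mult q a\<close> gives the triangle recursion, in the
  same shape as \<open>R_triangle_rec\<close>, so that the two can be matched term by term.\<close>

lemma int_coeff_row_poly_Suc:
  assumes "q \<ge> 2"
  shows "int_coeff (row_poly q a (Suc m)) z =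
    - of_int (a q - 1) * int_coeff (row_poly q a m) z
    - (\<Sum>e=2..q-1. of_int (a e - a (e + 1)) * int_coeff (row_poly q a m) (z - int q + int e))
    + of_int (1 + a 2) * int_coeff (row_poly q a m) (z - int q + 1)
    - int_coeff (row_poly q a m) (z - int q)"
proof -
  have S: "(\<Sum>e=2..q-1. of_int (a e - a (e + 1)) * int_coeff (row_poly q a m) (z - int (q - e))) =
      (\<Sum>e=2..q-1. of_int (a e - a (e + 1)) * int_coeff (row_poly q a m) (z - int q + int e))"
    by (intro sum.cong) (auto simp: of_nat_diff algebra_simps)
  have D: "z - int (q - 1) = z - int q + 1"
    using assms by linarith
  have "row_poly q a (Suc m) = row_mult q a * row_poly q a m"
    by (simp only: row_poly_def power_Suc mult.left_commute)
  then show ?thesis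
    by (simp only: row_mult_def distrib_right left_diff_distrib sum_distrib_right
      int_coeff_add int_coeff_diff int_coeff_sum int_coeff_monom_mult S D
      of_nat_0 diff_0_right mult_1)
qed

section \<open>From the recursion of order k to the triangle recursion\<close>

lemma taylor_seq_initial:
  assumes "r \<ge> 1" "n \<le> ord_k q r"
  shows "taylor_seq (T q a) (ord_k q r) n = (if n = 1 then 1 else 0)"
  using assms degree_pk[OF assms(1), of q a]
  by (simp add: taylor_seq_def pk_def rec_seq.simps)

lemma taylor_seq_rec:
  assumes "r \<ge> 1" "n > ord_k q r"
  shows "taylor_seq (T q a) (ord_k q r) n =
    (\<Sum>e<ord_k q r. coeff (pk q a r) e * taylor_seq (T q a) (ord_k q r) (n - ord_k q r + e))"
  using assms degree_pk[OF assms(1), of q a]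
  by (simp add: taylor_seq_def pk_def rec_seq.simps[of _ n])

text \<open>The coefficients come in three blocks: 1 at index 0, \<open>- a (e + 1)\<close> for
  \<open>1 \<le> e < q\<close>, and -1 from \<open>q\<close> on. Since \<open>f\<close> is
  arbitrary, this serves both the sequence and the entries of the rectangle.\<close>

lemma sum_coeff_pk:
  assumes "q \<ge> 2" "r \<ge> 1"
  shows "(\<Sum>e<ord_k q r. coeff (pk q a r) e * f e) =
    f 0 - (\<Sum>e=2..q. of_int (a e) * f (e - 1)) - (\<Sum>e=q..<ord_k q r. f e)"
proof -
  have k: "q < ord_k q r"
    by (rule q_le_ord_k[OF assms(2)])
  have "{..<ord_k q r} = insert 0 ({1..<q} \<union> {q..<ord_k q r})"
    using assms k by auto
  then have "(\<Sum>e<ord_k q r. coeff (pk q a r) e * f e) =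
      coeff (pk q a r) 0 * f 0 + ((\<Sum>e=1..<q. coeff (pk q a r) e * f e)
      + (\<Sum>e=q..<ord_k q r. coeff (pk q a r) e * f e))"
    using assms by (simp add: sum.union_disjoint ivl_disj_int)
  moreover have "(\<Sum>e=1..<q. coeff (pk q a r) e * f e) = (\<Sum>e=1..<q. - (of_int (a (e + 1)) * f e))"
    using k by (intro sum.cong) (auto simp: coeff_pk)
  moreover have "(\<Sum>e=1..<q. of_int (a (e + 1)) * f e) = (\<Sum>e=2..q. of_int (a e) * f (e - 1))"
    by (rule sum.reindex_bij_witness[of _ "\<lambda>e. e - 1" Suc]) auto
  moreover have "(\<Sum>e=q..<ord_k q r. coeff (pk q a r) e * f e) = (\<Sum>e=q..<ord_k q r. - f e)"
    using assms by (intro sum.cong) (auto simp: coeff_pk)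
  ultimately show ?thesis
    by (simp add: coeff_pk sum_negf)
qed

text \<open>Summation by parts moves the difference from \<open>h\<close> to \<open>b\<close>. This
  is the source of the factors \<open>a e - a (e + 1)\<close> in the triangle recursion.\<close>

lemma sum_by_parts:
  fixes b h :: "nat \<Rightarrow> 'a::comm_ring_1"
  assumes "q \<ge> 2"
  shows "(\<Sum>e=2..q. b e * (h e - h (e - 1))) =
    b q * h q + (\<Sum>e=2..q-1. (b e - b (e + 1)) * h e) - b 2 * h 1"
  using assms
proof (induction q rule: dec_induct)
  case base
  then show ?case by (simp add: algebra_simps)
next
  case (step n)
  then obtain m where "n = Suc m" "m \<ge> 1" by (cases n) auto
  with step.IH show ?case by (simp add: algebra_simps)
qed

text \<open>This ties the order to the row length: the oldest index used by the instance at
  \<open>z - 1\<close>, namely \<open>z - 1 - k\<close>, is \<open>z - c - q\<close>, which lies one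
  row up and \<open>q\<close> columns to the left.\<close>

lemma ord_k_eq_col_c:
  assumes "r \<ge> 1"
  shows "ord_k q r + 1 = col_c q r + q"
  using assms by (cases r) (auto simp: ord_k_def col_c_def)

text \<open>The index \<open>z\<close> is an integer so that no truncated subtraction occurs.\<close>

lemma taylor_seq_triangle_rec:
  fixes q r :: nat and a :: "nat \<Rightarrow> int" and z :: int
  defines "g \<equiv> \<lambda>z::int. taylor_seq (T q a) (ord_k q r) (nat z)"
  assumes q: "q \<ge> 2" and r: "r \<ge> 1" and z: "z \<ge> int (ord_k q r) + 2"
  shows "g z =
    - of_int (a q - 1) * g (z - col_c q r)
    - (\<Sum>e=2..q-1. of_int (a e - a (e + 1)) * g (z - col_c q r - int q + int e))
    + of_int (1 + a 2) * g (z - col_c q r - int q + 1)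
    - g (z - col_c q r - int q)"
proof -
  let ?k = "ord_k q r"
  \<comment> \<open>\<open>y\<close> is the oldest index in the instance at \<open>z - 1\<close>.
    The bound on \<open>z\<close> ensures that the instances at \<open>z\<close> and at
    \<open>z - 1\<close> both lie beyond the initial values.\<close>
  define y where "y = z - int ?k - 1"
  have rec: "g x = g (x - ?k) - (\<Sum>e=2..q. of_int (a e) * g (x - ?k + int (e - 1)))
      - (\<Sum>e=q..<?k. g (x - ?k + int e))" if "x > ?k" for x :: int
  proof -
    have "nat x - ?k + e = nat (x - ?k + int e)" for e
      using that by linarith
    then have "g x = (\<Sum>e<?k. coeff (pk q a r) e * g (x - ?k + int e))"
      unfolding g_def using taylor_seq_rec[OF r, of q "nat x" a] that by simp
    then show ?thesis
      by (simp add: sum_coeff_pk[OF q r])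
  qed
  have y: "z - col_c q r - int q = y"
    using ord_k_eq_col_c[OF r, of q] by (simp add: y_def)
  have c: "z - col_c q r = y + q"
    using y by simp
  have kq: "q \<le> ?k"
    using q_le_ord_k[OF r, of q] by simp
  have A: "g z = g (y + 1) - (\<Sum>e=2..q. of_int (a e) * g (y + int e)) - (\<Sum>e=q..<?k. g (y + int (Suc e)))"
  proof -
    have "(\<Sum>e=2..q. of_int (a e) * g (y + int e)) = (\<Sum>e=2..q. of_int (a e) * g (z - ?k + int (e - 1)))"
      by (intro sum.cong refl) (auto simp: y_def of_nat_diff algebra_simps)
    then show ?thesis
      using rec[of z] z by (simp add: y_def algebra_simps)
  qed
  have B: "g (z - 1) = g y - (\<Sum>e=2..q. of_int (a e) * g (y + int (e - 1))) - (\<Sum>e=q..<?k. g (y + int e))"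
    using rec[of "z - 1"] z by (simp add: y_def algebra_simps)
  \<comment> \<open>The long tails with coefficient -1 telescope. Their \<open>g (z - 1)\<close>
    cancels the one from the left-hand side of \<open>B\<close>, and their \<open>g (y + q)\<close>
    turns the factor \<open>- a q\<close> into \<open>- (a q - 1)\<close>.\<close>
  have tel: "(\<Sum>e=q..<?k. g (y + int (Suc e))) - (\<Sum>e=q..<?k. g (y + int e)) = g (z - 1) - g (y + q)"
    using sum_Suc_diff'[OF kq, of "\<lambda>e. g (y + int e)"] by (simp add: sum_subtractf y_def)
  have "(\<Sum>e=2..q. of_int (a e) * g (y + int e)) - (\<Sum>e=2..q. of_int (a e) * g (y + int (e - 1))) =
      of_int (a q) * g (y + int q) + (\<Sum>e=2..q-1. of_int (a e - a (e + 1)) * g (y + int e))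
      - of_int (a 2) * g (y + 1)"
    using sum_by_parts[OF q, of "\<lambda>e. of_int (a e)" "\<lambda>e. g (y + int e)"]
    by (simp add: sum_subtractf right_diff_distrib)
  with A B tel show ?thesis
    unfolding y unfolding c by (simp add: algebra_simps)
qed

section \<open>The rows of the rectangle\<close>

lemma R_first_row:
  assumes "q \<ge> 2" "r \<ge> 1" "1 \<le> j" "j \<le> int (col_c q r)"
  shows "R q a r 1 j = int_coeff (row_poly q a 0) (j - 1)"
proof -
  let ?k = "ord_k q r" and ?c = "col_c q r"
  define g where "g = (\<lambda>z::int. taylor_seq (T q a) ?k (nat z))"
  have g0: "g z = (if z = 1 then 1 else 0)" if "z \<le> ?k" for z :: int
    using that taylor_seq_initial[OF assms(2), of "nat z" q a] by (auto simp: g_def)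
  have kc: "int ?k + 1 = int ?c + int q"
    using ord_k_eq_col_c[OF assms(2), of q] by linarith
  have R: "R q a r 1 j = g (?k + j)"
    by (simp add: R_def rect_def g_def)
  show ?thesis
  proof (cases "j = 1")
    case True
    \<comment> \<open>Index \<open>k + 1\<close> is too early for the triangle recursion, so column
      1 uses the original one; of the values it reads only the one at index 1 is nonzero.\<close>
    have S: "(\<Sum>e<?k. coeff (pk q a r) e * taylor_seq (T q a) ?k (1 + e)) =
        (\<Sum>e<?k. if e = 0 then 1 else 0)"
      using assms by (intro sum.cong) (auto simp: taylor_seq_initial coeff_pk)
    have "nat (int ?k + 1) = ?k + 1" by simp
    then have "g (?k + 1) = 1"
      using taylor_seq_rec[OF assms(2), of q "?k + 1" a] S by (simp add: g_def ord_k_def)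
    with True R show ?thesis by (simp add: int_coeff_row_poly_0 add.commute)
  next
    case False
    \<comment> \<open>All indices read by the triangle recursion are now at most \<open>k\<close>.
      Only the oldest, \<open>?z - c - q = j - 1\<close>, can be 1, and it is so exactly for
      \<open>j = 2\<close>.\<close>
    let ?z = "int ?k + j"
    have "(\<Sum>e=2..q-1. of_int (a e - a (e + 1)) * g (?z - ?c - int q + int e)) = 0"
      using kc assms False by (intro sum.neutral) (auto simp: g0)
    moreover have "g (?z - ?c) = 0" "g (?z - ?c - int q + 1) = 0"
      using kc assms False by (auto simp: g0)
    moreover have "g (?z - ?c - int q) = (if j = 2 then 1 else 0)"
      using kc assms False by (auto simp: g0)
    ultimately have "g ?z = (if j = 2 then - 1 else 0)"
      using taylor_seq_triangle_rec[OF assms(1,2), of ?z a] assms(3) False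
      unfolding g_def by simp
    with R False show ?thesis by (simp add: int_coeff_row_poly_0)
  qed
qed

lemma R_triangle_rec:
  assumes "q \<ge> 2" "r \<ge> 1" "i \<ge> 2" "j \<ge> 1"
  shows "R q a r i j =
    - of_int (a q - 1) * R q a r (i - 1) j
    - (\<Sum>e=2..q-1. of_int (a e - a (e + 1)) * R q a r (i - 1) (j - int q + int e))
    + of_int (1 + a 2) * R q a r (i - 1) (j - int q + 1)
    - R q a r (i - 1) (j - int q)"
proof -
  let ?k = "ord_k q r" and ?c = "col_c q r"
  let ?z = "int ?k + (i - 1) * int ?c + j"
  have "1 * int ?c \<le> (i - 1) * int ?c"
    using assms by (intro mult_right_mono) auto
  moreover have "?c \<ge> 2"
    by (simp add: col_c_def)
  ultimately have "?z \<ge> int ?k + 2"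
    using assms by linarith
  moreover have "R q a r (i - 1) u = taylor_seq (T q a) ?k (nat (?z - ?c - j + u))" for u
    unfolding R_def rect_def by (simp add: algebra_simps)
  ultimately show ?thesis
    using taylor_seq_triangle_rec[OF assms(1,2), of ?z a]
    by (simp add: R_def rect_def algebra_simps)
qed

lemma R_rec:
  assumes "q \<ge> 2" "r \<ge> 1" "i \<ge> 1" "j \<ge> 1"
  shows "R q a r i j =
    (\<Sum>e<ord_k q r. coeff (pk q a r) e * R q a r i (j - int (ord_k q r) + int e))"
proof -
  let ?k = "ord_k q r" and ?c = "col_c q r"
  define m where "m = nat (int ?k + (i - 1) * int ?c + j)"
  have "0 \<le> (i - 1) * int ?c"
    using assms by simp
  then have m: "int m = int ?k + (i - 1) * int ?c + j" "m > ?k"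
    using assms unfolding m_def by linarith+
  have "nat (int ?k + (i - 1) * int ?c + (j - int ?k + int e)) = m - ?k + e" for e
    using m by linarith
  then show ?thesis
    using taylor_seq_rec[OF assms(2) m(2), of a] by (simp add: R_def rect_def m_def)
qed

lemma l_pos_le_col_c:
  assumes "1 \<le> t" "t \<le> int r"
  shows "l_pos q t \<le> int (col_c q r)"
  using assms by (auto simp: l_pos_def col_c_def of_nat_diff intro!: mult_right_mono)

text \<open>Induction over all smaller \<open>m\<close> is needed: the recursion reads the preceding
  row, and its columns below 1 are entries of the row before that.\<close>

lemma R_eq_int_coeff_row_poly:
  assumes "q \<ge> 2" "m < r" "1 \<le> j" "j \<le> int (col_c q r)"
  shows "R q a r (int m + 1) j = int_coeff (row_poly q a m) (j - 1)"
  using assms(2-)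
proof (induction m arbitrary: j rule: less_induct)
  case (less m)
  let ?c = "col_c q r"
  show ?case
  proof (cases m)
    case 0
    with less.prems R_first_row[OF assms(1)] show ?thesis by simp
  next
    case (Suc m')
    \<comment> \<open>Columns below 1 are the wrapped-around ones; they sit in the zero tail of the row before.\<close>
    have prev: "R q a r (int m' + 1) u = int_coeff (row_poly q a m') (u - 1)"
      if u: "1 - int q \<le> u" "u \<le> ?c" for u
    proof (cases "u \<ge> 1")
      case True
      with less.IH[of m' u] less.prems Suc u show ?thesis by simp
    next
      case False
      \<comment> \<open>Since \<open>Suc m' < r\<close>, the row length is at least
        \<open>2 + m' * q + q\<close>. A wrap by fewer than \<open>q\<close> columns past column 0
        therefore still lands at column \<open>m' * q + 3\<close> or later.\<close>
      have "int (m' * q) \<le> int ((r - 2) * q)"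
        using less.prems Suc by (intro of_nat_mono mult_right_mono) auto
      moreover have "?c = 2 + (r - 2) * q + q"
      proof -
        have "r - 1 = Suc (r - 2)" using less.prems Suc by simp
        then show ?thesis by (simp add: col_c_def)
      qed
      ultimately have u': "int m' * int q + 3 \<le> ?c + u"
        using u by simp
      have le: "?c + u \<le> ?c"
        using False by simp
      have w: "R q a r (int m' + 1) u = R q a r (int m') (?c + u)"
        using rect_wrap[of q a r "int m' + 1" "1 - u"] by simp
      have "R q a r (int m') (?c + u) = 0"
      proof (cases m')
        \<comment> \<open>Here the wrapped entries fall into row 0, that is, among the vanishing
          initial values.\<close>
        case 0
        with u' le rect_row0[OF assms(1), of r "?c + u" a] less.prems show ?thesis by simp
      next
        case (Suc m'')
        have "0 \<le> int m' * int q" by simp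
        with u' have "1 \<le> ?c + u" by linarith
        then have "R q a r (int m') (?c + u) = int_coeff (row_poly q a m'') (?c + u - 1)"
          using less.IH[of m'' "?c + u"] less.prems Suc le \<open>m = Suc m'\<close> by (simp add: add.commute)
        also have "\<dots> = 0"
          using u' Suc by (intro int_coeff_eq_0) (simp add: degree_row_poly assms(1) algebra_simps)
        finally show ?thesis .
      qed
      with w False show ?thesis by (simp add: int_coeff_def)
    qed
    have "(\<Sum>e=2..q-1. of_int (a e - a (e + 1)) * R q a r (int m' + 1) (j - int q + int e)) =
        (\<Sum>e=2..q-1. of_int (a e - a (e + 1)) * int_coeff (row_poly q a m') (j - 1 - int q + int e))"
    proof (intro sum.cong refl)
      fix e assume e: "e \<in> {2..q-1}"
      then have "R q a r (int m' + 1) (j - int q + int e) =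
          int_coeff (row_poly q a m') (j - int q + int e - 1)"
        using less.prems by (intro prev) auto
      then show "of_int (a e - a (e + 1)) * R q a r (int m' + 1) (j - int q + int e) =
          of_int (a e - a (e + 1)) * int_coeff (row_poly q a m') (j - 1 - int q + int e)"
        by (simp add: algebra_simps)
    qed
    moreover have "R q a r (int m' + 1) j = int_coeff (row_poly q a m') (j - 1)"
      using less.prems by (intro prev) auto
    moreover have "R q a r (int m' + 1) (j - int q + 1) = int_coeff (row_poly q a m') (j - 1 - int q + 1)"
      using less.prems assms(1) prev[of "j - int q + 1"] by (simp add: algebra_simps)
    moreover have "R q a r (int m' + 1) (j - int q) = int_coeff (row_poly q a m') (j - 1 - int q)"
      using less.prems prev[of "j - int q"] by (simp add: algebra_simps)
    moreover have "int m + 1 - 1 = int m' + 1"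
      using Suc by simp
    moreover have "R q a r (int m + 1) j =
      - of_int (a q - 1) * R q a r (int m + 1 - 1) j
      - (\<Sum>e=2..q-1. of_int (a e - a (e + 1)) * R q a r (int m + 1 - 1) (j - int q + int e))
      + of_int (1 + a 2) * R q a r (int m + 1 - 1) (j - int q + 1)
      - R q a r (int m + 1 - 1) (j - int q)"
      using less.prems Suc assms(1) by (intro R_triangle_rec) auto
    ultimately show ?thesis
      unfolding Suc int_coeff_row_poly_Suc[OF assms(1)] by (simp only:)
  qed
qed

section \<open>Nonzero entries and compatibility\<close>

corollary R_eq_row_poly:
  assumes "q \<ge> 2" "t \<in> {1..int r}" "1 \<le> j" "j \<le> int (col_c q r)"
  shows "R q a r t j = int_coeff (row_poly q a (nat (t - 1))) (j - 1)"
  using R_eq_int_coeff_row_poly[OF assms(1), of "nat (t - 1)" r j a] assms by auto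

text \<open>The last nonzero entry is the leading coefficient of the row polynomial; its column is
  the degree plus 1.\<close>

lemma last_nonzero_R:
  assumes "q \<ge> 2" "t \<in> {1..int r}"
  shows "last_nonzero (R q a r t) (col_c q r) (l_pos q t)"
proof -
  let ?P = "row_poly q a (nat (t - 1))"
  have deg: "int (degree ?P) = l_pos q t - 1"
    using assms by (simp add: degree_row_poly l_pos_def)
  then have l1: "1 \<le> l_pos q t" by linarith
  have lc: "l_pos q t \<le> col_c q r"
    using assms l_pos_le_col_c by auto
  have "nat (l_pos q t - 1) = degree ?P"
    using deg by linarith
  then have "int_coeff ?P (l_pos q t - 1) \<noteq> 0"
    using l1 row_poly_nonzero[OF assms(1)] by (simp add: int_coeff_def)
  moreover have "R q a r t u = 0" if "l_pos q t < u" "u \<le> col_c q r" for u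
    using that l1 deg by (simp add: R_eq_row_poly[OF assms] int_coeff_eq_0)
  ultimately show ?thesis
    using l1 lc by (auto simp: last_nonzero_def R_eq_row_poly[OF assms])
qed

lemma R_first_column_nonzero:
  assumes "q \<ge> 2" "a q \<noteq> 1" "t \<in> {1..int r}"
  shows "R q a r t 1 \<noteq> 0"
proof -
  have "R q a r t 1 = (- of_int (a q - 1)) ^ nat (t - 1)"
    using R_eq_row_poly[OF assms(1,3), of 1 a]
    by (simp add: col_c_def int_coeff_def coeff_row_poly_0[OF assms(1)])
  with assms(2) show ?thesis by simp
qed

lemma strict_mono_on_l_pos:
  assumes "q \<ge> 1"
  shows "strict_mono_on A (l_pos q)"
  using assms by (auto simp: strict_mono_on_def l_pos_def)

theorem theorem2p1:
  fixes q :: nat and a :: "nat \<Rightarrow> int"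
  assumes "q \<ge> 2"
    and "\<forall>i\<in>{2..q}. a i \<ge> 1"
    and "a q \<ge> 2"
  shows
    "(\<forall>r\<ge>1.
        \<comment> \<open>(i)\<close>
        (R q a r 1 1 = 1 \<and> R q a r 1 2 = - 1 \<and>
         (\<forall>u\<in>{3..int (col_c q r)}. R q a r 1 u = 0)) \<and>
        \<comment> \<open>(ii): the recursion defining the sequence, its explicit form, the triangle recursion\<close>
        (\<forall>i\<in>{2..int r}. \<forall>j\<in>{1..int (col_c q r)}.
           R q a r i j =
             (\<Sum>e<ord_k q r. coeff (pk q a r) e * R q a r i (j - int (ord_k q r) + int e)) \<and>
           R q a r i j =
             R q a r i (j - int (ord_k q r))
             - (\<Sum>e=2..q. of_int (a e) * R q a r i (j - int (ord_k q r) + int e - 1))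
             - (\<Sum>e=q..<ord_k q r. R q a r i (j - int (ord_k q r) + int e)) \<and>
           R q a r i j =
             - of_int (a q - 1) * R q a r (i - 1) j
             - (\<Sum>e=2..q-1. of_int (a e - a (e + 1)) * R q a r (i - 1) (j - int q + int e))
             + of_int (1 + a 2) * R q a r (i - 1) (j - int q + 1)
             - R q a r (i - 1) (j - int q)) \<and>
        \<comment> \<open>(iii)\<close>
        (\<forall>t\<in>{1..int r}. R q a r t 1 \<noteq> 0) \<and>
        \<comment> \<open>(iv)\<close>
        (\<forall>t\<in>{1..int r}.
           R q a r t (l_pos q t) \<noteq> 0 \<and>
           (\<forall>u. l_pos q t < u \<and> u \<le> int (col_c q r) \<longrightarrow> R q a r t u = 0) \<and>
           last_nonzero (R q a r t) (col_c q r) (l_pos q t))) \<and>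
     \<comment> \<open>(v)\<close>
     family_triangle_embedded (taylor_seq (T q a)) (ord_k q) (col_c q) \<and>
     (\<forall>r\<ge>1. strict_mono_on {1..int r} (l_pos q)) \<and>
     (\<forall>r1\<ge>1. \<forall>r2\<ge>1. \<forall>t\<in>{1..int (min r1 r2)}.
        last_nonzero (R q a r1 t) (col_c q r1) (l_pos q t) \<and>
        last_nonzero (R q a r2 t) (col_c q r2) (l_pos q t) \<and>
        (\<forall>s\<in>{1..l_pos q t}. R q a r1 t s = R q a r2 t s))"
proof (intro conjI allI impI ballI)
  fix r :: nat assume r: "r \<ge> 1"
  have c: "col_c q r \<ge> 2"
    by (simp add: col_c_def)
  show "R q a r 1 1 = 1" "R q a r 1 2 = - 1"
    using r c assms(1) by (simp_all add: R_first_row int_coeff_row_poly_0)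
  show "R q a r 1 u = 0" if "u \<in> {3..int (col_c q r)}" for u
    using r that assms(1) by (simp add: R_first_row int_coeff_row_poly_0)
  show "strict_mono_on {1..int r} (l_pos q)"
    using assms(1) by (intro strict_mono_on_l_pos) simp
  show "R q a r t 1 \<noteq> 0" if "t \<in> {1..int r}" for t
    using that assms by (intro R_first_column_nonzero) auto
  {
    fix t assume "t \<in> {1..int r}"
    then show last: "last_nonzero (R q a r t) (col_c q r) (l_pos q t)"
      by (rule last_nonzero_R[OF assms(1)])
    then show "R q a r t (l_pos q t) \<noteq> 0"
      by (simp add: last_nonzero_def)
    show "R q a r t u = 0" if "l_pos q t < u \<and> u \<le> int (col_c q r)" for u
      using last that by (simp add: last_nonzero_def)
  }
  fix i j assume "i \<in> {2..int r}" "j \<in> {1..int (col_c q r)}"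
  then have ij: "i \<ge> 2" "j \<ge> 1" "i \<ge> 1" by auto
  show rec: "R q a r i j =
      (\<Sum>e<ord_k q r. coeff (pk q a r) e * R q a r i (j - int (ord_k q r) + int e))"
    using assms(1) r ij by (intro R_rec)
  have "(\<Sum>e=2..q. of_int (a e) * R q a r i (j - int (ord_k q r) + int (e - 1))) =
      (\<Sum>e=2..q. of_int (a e) * R q a r i (j - int (ord_k q r) + int e - 1))"
    by (intro sum.cong refl) (auto simp: of_nat_diff algebra_simps)
  then show "R q a r i j =
      R q a r i (j - int (ord_k q r))
      - (\<Sum>e=2..q. of_int (a e) * R q a r i (j - int (ord_k q r) + int e - 1))
      - (\<Sum>e=q..<ord_k q r. R q a r i (j - int (ord_k q r) + int e))"
    using rec by (simp add: sum_coeff_pk[OF assms(1) r])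
  show "R q a r i j =
      - of_int (a q - 1) * R q a r (i - 1) j
      - (\<Sum>e=2..q-1. of_int (a e - a (e + 1)) * R q a r (i - 1) (j - int q + int e))
      + of_int (1 + a 2) * R q a r (i - 1) (j - int q + 1)
      - R q a r (i - 1) (j - int q)"
    using assms(1) r ij by (intro R_triangle_rec)
next
  show "family_triangle_embedded (taylor_seq (T q a)) (ord_k q) (col_c q)"
    unfolding family_triangle_embedded_def triangle_embedded_def R_def[symmetric]
    using last_nonzero_R[OF assms(1)] strict_mono_on_l_pos[of q] assms(1)
    by (intro allI impI exI[of _ "l_pos q"]) auto
next
  fix r1 r2 :: nat and t assume "t \<in> {1..int (min r1 r2)}"
  then have t: "t \<in> {1..int r1}" "t \<in> {1..int r2}" by auto
  show "last_nonzero (R q a r1 t) (col_c q r1) (l_pos q t)"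
    "last_nonzero (R q a r2 t) (col_c q r2) (l_pos q t)"
    using t by (auto intro!: last_nonzero_R assms(1))
  have "l_pos q t \<le> col_c q r1" "l_pos q t \<le> col_c q r2"
    using t l_pos_le_col_c by auto
  \<comment> \<open>Column \<open>s\<close> fits into both rectangles, and both entries are the same
    coefficient of one row polynomial, in which neither \<open>r1\<close> nor \<open>r2\<close>
    occurs.\<close>
  then show "R q a r1 t s = R q a r2 t s" if "s \<in> {1..l_pos q t}" for s
    using that by (simp add: R_eq_row_poly[OF assms(1) t(1)] R_eq_row_poly[OF assms(1) t(2)])
qed

end
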